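(* Let $k\geq 3$. If $G$ is a connected graph with $c(G) = \theta(G) = k$, then for every integer $t$ with $3 \leq t \leq k+1$, $G$ contains an induced cycle of length $t$.
   Context: All graphs are finite and simple. The Cops and Robbers game on a graph $G$: first the cop player places $m$ cops on vertices (several may share a vertex), then the robber is placed on a vertex; the players then alternate turns, starting with the cops. On the cops' turn each cop either moves to an adjacent vertex or stays; on the robber's turn the robber moves to an adjacent vertex or stays. The cops win if after finitely many moves some cop occupies the robber's vertex; the robber wins if he can evade capture forever. The cop number $c(G)$ is the least $m$ such that $m$ cops can always win. The clique cover number $\theta(G)$ is the least number of cliques whose vertex sets partition $V(G)$. *)

theory Defs
  imports "Graph_Theory.Graph_Theory" "HOL-Library.Disjoint_Sets"
begin

text \<open>
  A finite simple graph is a symmetric digraph satisfying the locale predicate \<^term>\<open>graph\<close>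
  (finite, no loops, no parallel arcs); adjacency is \<open>u \<rightarrow>\<^bsub>G\<^esub> v\<close>. The predicate \<open>connected\<close> of
  Graph_Theory includes that the vertex set is nonempty.
\<close>

definition move :: "('a, 'b) pre_digraph \<Rightarrow> 'a \<Rightarrow> 'a \<Rightarrow> bool" where
  "move G u v \<longleftrightarrow> u \<in> verts G \<and> v \<in> verts G \<and> (u = v \<or> u \<rightarrow>\<^bsub>G\<^esub> v)"

text \<open>
  In a play, \<open>r 0\<close> is the robber's initial vertex and \<open>r n\<close> his vertex after his \<open>n\<close>-th move.
\<close>

definition robber_play :: "('a, 'b) pre_digraph \<Rightarrow> (nat \<Rightarrow> 'a) \<Rightarrow> bool" where
  "robber_play G r \<longleftrightarrow> r 0 \<in> verts G \<and> (\<forall>n. move G (r n) (r (Suc n)))"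

text \<open>
  A strategy \<open>s\<close> of the cops maps the list of robber positions seen so far to the list of the cops'
  current vertices. Thus \<open>s []\<close> is the initial placement, chosen before the robber is placed, and
  \<open>s [r 0, \<dots>, r n]\<close> is the placement after the cops' answer to the robber position \<open>r n\<close>. The
  earlier cop positions are not passed as arguments, since \<open>s\<close> determines them.
\<close>

definition cop_pos :: "('a list \<Rightarrow> 'a list) \<Rightarrow> (nat \<Rightarrow> 'a) \<Rightarrow> nat \<Rightarrow> 'a list" where
  "cop_pos s r n = s (map r [0..<n])"

definition cop_strategy ::
    "('a, 'b) pre_digraph \<Rightarrow> nat \<Rightarrow> ('a list \<Rightarrow> 'a list) \<Rightarrow> bool" where
  "cop_strategy G m s \<longleftrightarrow>
     length (s []) = m \<and> set (s []) \<subseteq> verts G \<and>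
     (\<forall>r. robber_play G r \<longrightarrow>
        (\<forall>n. list_all2 (move G) (cop_pos s r n) (cop_pos s r (Suc n))))"

text \<open>
  The positions alternate \<open>cop_pos s r 0, r 0, cop_pos s r 1, r 1, \<dots>\<close>, so the robber is caught
  either right after his own \<open>n\<close>-th move (or placement) or right after the cops' next move.
\<close>

definition captures :: "('a list \<Rightarrow> 'a list) \<Rightarrow> (nat \<Rightarrow> 'a) \<Rightarrow> bool" where
  "captures s r \<longleftrightarrow> (\<exists>n. r n \<in> set (cop_pos s r n) \<or> r n \<in> set (cop_pos s r (Suc n)))"

definition cops_win :: "('a, 'b) pre_digraph \<Rightarrow> nat \<Rightarrow> bool" where
  "cops_win G m \<longleftrightarrow> (\<exists>s. cop_strategy G m s \<and> (\<forall>r. robber_play G r \<longrightarrow> captures s r))"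

definition cop_number :: "('a, 'b) pre_digraph \<Rightarrow> nat" where
  "cop_number G = (LEAST m. cops_win G m)"

definition clique :: "('a, 'b) pre_digraph \<Rightarrow> 'a set \<Rightarrow> bool" where
  "clique G C \<longleftrightarrow> C \<subseteq> verts G \<and> (\<forall>u\<in>C. \<forall>v\<in>C. u \<noteq> v \<longrightarrow> u \<rightarrow>\<^bsub>G\<^esub> v)"

definition clique_partition :: "('a, 'b) pre_digraph \<Rightarrow> 'a set set \<Rightarrow> bool" where
  "clique_partition G P \<longleftrightarrow> finite P \<and> partition_on (verts G) P \<and> (\<forall>C\<in>P. clique G C)"

definition clique_cover_number :: "('a, 'b) pre_digraph \<Rightarrow> nat" where
  "clique_cover_number G = (LEAST n. \<exists>P. clique_partition G P \<and> card P = n)"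

definition cycle_graph :: "nat \<Rightarrow> ('a, 'b) pre_digraph \<Rightarrow> bool" where
  "cycle_graph t H \<longleftrightarrow> t \<ge> 3 \<and>
     (\<exists>vs. distinct vs \<and> length vs = t \<and> set vs = verts H \<and>
        (\<forall>i<t. \<forall>j<t. vs ! i \<rightarrow>\<^bsub>H\<^esub> vs ! j \<longleftrightarrow> j = Suc i mod t \<or> i = Suc j mod t))"

definition has_induced_cycle :: "('a, 'b) pre_digraph \<Rightarrow> nat \<Rightarrow> bool" where
  "has_induced_cycle G t \<longleftrightarrow> (\<exists>H. induced_subgraph H G \<and> cycle_graph t H)"

end

theory Submission
  imports Defs
begin

text \<open>
  Fix a partition of the vertices into cliques \<open>Q 0, \<dots>, Q (k - 1)\<close> and let \<open>k - 1\<close> cops play against a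
  robber who evades them forever. Whenever \<open>k - 1\<close> cliques contain a cop, the robber must be in the
  remaining clique, and a cop entering that clique from \<open>Q i\<close> forces him to move to \<open>Q i\<close>, if all
  other cliques stay occupied. Hence any two cliques are joined by an edge, since otherwise one cop
  could leave his clique and walk to the robber, who is unable to move out of his. The robber
  can then be chased through \<open>Q 0, \<dots>, Q (k - 1)\<close> in this order while the cops occupy the vertices that
  he has left; his trail is an induced path \<open>v 0, \<dots>, v (k - 1)\<close>. Finally let cops stand on
  \<open>v 0, \<dots>, v (m - 2)\<close> and on the cliques \<open>Q m, \<dots>, Q (k - 1)\<close>, and let those on the path all advance by
  one vertex: the robber moves from some \<open>x\<close> in \<open>Q (m - 1)\<close> to some \<open>y\<close> in \<open>Q 0\<close>, and
  \<open>v 0, \<dots>, v (m - 1), x, y\<close> is an induced cycle of length \<open>m + 2\<close>. A triangle is found inside a clique.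
\<close>

section \<open>Winning positions\<close>

text \<open>Positions with the cops to move from which they can force a capture.\<close>

inductive cops_force :: "('a, 'b) pre_digraph \<Rightarrow> 'a list \<Rightarrow> 'a \<Rightarrow> bool" for G where
  caught: "r \<in> set c \<Longrightarrow> cops_force G c r"
| catch: "list_all2 (move G) c c' \<Longrightarrow> r \<in> set c' \<Longrightarrow> cops_force G c r"
| step: "list_all2 (move G) c c' \<Longrightarrow> (\<And>r'. move G r r' \<Longrightarrow> cops_force G c' r') \<Longrightarrow> cops_force G c r"

lemma list_all2_move_refl: "set c \<subseteq> verts G \<Longrightarrow> list_all2 (move G) c c"
  by (auto simp: list_all2_conv_all_nth move_def)

lemma list_all2_move_verts: "list_all2 (move G) c c' \<Longrightarrow> set c' \<subseteq> verts G"
  by (auto simp: list_all2_conv_all_nth move_def in_set_conv_nth)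

text \<open>Induction on the derivation. Demanding \<open>s [] = c\<close> lets the strategies for
  the various robber answers, all starting from the same \<open>c'\<close>, be glued into
  one.\<close>

lemma cops_force_strategy:
  assumes "cops_force G c r" "set c \<subseteq> verts G"
  shows "\<exists>s. s [] = c \<and> (\<forall>\<rho>. robber_play G \<rho> \<and> \<rho> 0 = r \<longrightarrow>
    (\<forall>n. list_all2 (move G) (cop_pos s \<rho> n) (cop_pos s \<rho> (Suc n))) \<and> captures s \<rho>)"
  using assms
proof (induction rule: cops_force.induct)
  case (caught r c)
  then show ?case
    by (intro exI[of _ "\<lambda>_. c"])
      (auto simp: cop_pos_def captures_def list_all2_move_refl intro!: exI[of _ 0])
next
  case (catch c c' r)
  have "set c' \<subseteq> verts G"
    using catch list_all2_move_verts by blast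
  then have refl: "list_all2 (move G) c' c'"
    by (rule list_all2_move_refl)
  define s where "s l = (if l = [] then c else c')" for l :: "'a list"
  have pos: "cop_pos s \<rho> 0 = c" "cop_pos s \<rho> (Suc n) = c'" for \<rho> n
    by (simp_all add: cop_pos_def s_def)
  have "list_all2 (move G) (cop_pos s \<rho> n) (cop_pos s \<rho> (Suc n))" for \<rho> n
    using catch.hyps(1) refl by (cases n) (simp_all only: pos)
  moreover have "captures s \<rho>" if "\<rho> 0 = r" for \<rho>
    unfolding captures_def using catch.hyps(2) that pos by metis
  moreover have "s [] = c"
    by (simp add: s_def)
  ultimately show ?case
    by blast
next
  case (step c c' r)
  have "set c' \<subseteq> verts G"
    using step list_all2_move_verts by blast
  then have "\<forall>r'\<in>Collect (move G r). \<exists>s. s [] = c' \<and> (\<forall>\<rho>. robber_play G \<rho> \<and> \<rho> 0 = r' \<longrightarrow>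
    (\<forall>n. list_all2 (move G) (cop_pos s \<rho> n) (cop_pos s \<rho> (Suc n))) \<and> captures s \<rho>)"
    using step.IH by simp
  then obtain t where t': "\<forall>r'\<in>Collect (move G r). t r' [] = c' \<and>
    (\<forall>\<rho>. robber_play G \<rho> \<and> \<rho> 0 = r' \<longrightarrow>
      (\<forall>n. list_all2 (move G) (cop_pos (t r') \<rho> n) (cop_pos (t r') \<rho> (Suc n))) \<and> captures (t r') \<rho>)"
    by (rule bchoice[THEN exE]) blast
  have t: "t r' [] = c'" "robber_play G \<rho> \<Longrightarrow> \<rho> 0 = r' \<Longrightarrow>
      (\<forall>n. list_all2 (move G) (cop_pos (t r') \<rho> n) (cop_pos (t r') \<rho> (Suc n))) \<and> captures (t r') \<rho>"
    if "move G r r'" for r' \<rho>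
    using t'[rule_format, of r'] that by simp_all
  \<comment> \<open>The first robber position \<open>r\<close> is fixed, so the second entry of the
    history is the answer that selects \<open>t\<close>; the selected strategy sees the history
    without \<open>r\<close>.\<close>
  define s where "s l = (if l = [] then c else if tl l = [] then c' else t (hd (tl l)) (tl l))" for l
  show ?case
  proof (intro exI[of _ s] conjI allI impI)
    show "s [] = c"
      by (simp add: s_def)
  next
    fix \<rho> assume \<rho>: "robber_play G \<rho> \<and> \<rho> 0 = r"
    let ?\<rho> = "\<lambda>i. \<rho> (Suc i)"
    have m: "move G r (\<rho> 1)"
      using \<rho> by (auto simp: robber_play_def)
    have p: "robber_play G ?\<rho>"
      using \<rho> by (auto simp: robber_play_def move_def)
    have c0: "cop_pos s \<rho> 0 = c" and c1: "cop_pos s \<rho> (Suc 0) = c'"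
      by (simp_all add: cop_pos_def s_def)
    have cs: "cop_pos s \<rho> (Suc n) = cop_pos (t (\<rho> 1)) ?\<rho> n" for n
      using t(1)[OF m]
      by (cases n) (simp_all add: cop_pos_def s_def map_upt_Suc del: upt_Suc)
    note t2 = t(2)[OF m p]
    { fix n show "list_all2 (move G) (cop_pos s \<rho> n) (cop_pos s \<rho> (Suc n))"
        using t2 step.hyps(1) c0 c1 by (cases n) (auto simp: cs) }
    show "captures s \<rho>"
      using t2 unfolding captures_def cs[symmetric] by auto
  qed
qed

text \<open>The same gluing, now over the robber's initial vertex, read off as the head of the
  history.\<close>

lemma cops_win_if_cops_force:
  assumes "length c = m" "set c \<subseteq> verts G" "\<And>r. r \<in> verts G \<Longrightarrow> cops_force G c r"
  shows "cops_win G m"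
proof -
  have "\<forall>r\<in>verts G. \<exists>s. s [] = c \<and> (\<forall>\<rho>. robber_play G \<rho> \<and> \<rho> 0 = r \<longrightarrow>
    (\<forall>n. list_all2 (move G) (cop_pos s \<rho> n) (cop_pos s \<rho> (Suc n))) \<and> captures s \<rho>)"
    by (intro ballI cops_force_strategy assms)
  then obtain t where t': "\<forall>r\<in>verts G. t r [] = c \<and> (\<forall>\<rho>. robber_play G \<rho> \<and> \<rho> 0 = r \<longrightarrow>
    (\<forall>n. list_all2 (move G) (cop_pos (t r) \<rho> n) (cop_pos (t r) \<rho> (Suc n))) \<and> captures (t r) \<rho>)"
    by (rule bchoice[THEN exE]) blast
  have t: "t r [] = c" "robber_play G \<rho> \<Longrightarrow> \<rho> 0 = r \<Longrightarrow>
      (\<forall>n. list_all2 (move G) (cop_pos (t r) \<rho> n) (cop_pos (t r) \<rho> (Suc n))) \<and> captures (t r) \<rho>"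
    if "r \<in> verts G" for r \<rho>
    using t' that by simp_all
  define s where "s l = (if l = [] then c else t (hd l) l)" for l
  have cs: "cop_pos s \<rho> n = cop_pos (t (\<rho> 0)) \<rho> n" if "robber_play G \<rho>" for \<rho> n
    using that t(1)
    by (cases n) (simp_all add: cop_pos_def s_def robber_play_def map_upt_Suc del: upt_Suc)
  have "cop_strategy G m s \<and> (\<forall>\<rho>. robber_play G \<rho> \<longrightarrow> captures s \<rho>)"
    using t(2) assms(1,2)
    by (auto simp: cop_strategy_def captures_def cs s_def robber_play_def)
  then show ?thesis
    unfolding cops_win_def by blast
qed

section \<open>Evading one cop fewer than there are cliques\<close>

text \<open>
  The cops are named by the elements of a set \<open>I\<close> of \<open>k - 1\<close> indices; usually cop \<open>i\<close> starts in \<open>Q i\<close>.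
\<close>

definition safe :: "('a, 'b) pre_digraph \<Rightarrow> nat set \<Rightarrow> (nat \<Rightarrow> 'a) \<Rightarrow> 'a \<Rightarrow> bool" where
  "safe G I p r \<longleftrightarrow> r \<in> verts G \<and> \<not> cops_force G (map p (sorted_list_of_set I)) r"

text \<open>The rule \<open>cops_force.step\<close> read backwards: no cop move can make every
  robber answer losing.\<close>

lemma safe_move:
  assumes "safe G I p r" "finite I" "\<And>i. i \<in> I \<Longrightarrow> move G (p i) (q i)"
  obtains r' where "move G r r'" "safe G I q r'"
proof -
  have "list_all2 (move G) (map p (sorted_list_of_set I)) (map q (sorted_list_of_set I))"
    using assms by (auto simp: list_all2_map1 list_all2_map2 intro: list.rel_refl_strong)
  then have "\<exists>r'. move G r r' \<and> \<not> cops_force G (map q (sorted_list_of_set I)) r'"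
    using assms(1) cops_force.step unfolding safe_def by metis
  then show ?thesis
    using that unfolding safe_def move_def by blast
qed

text \<open>The rule \<open>cops_force.catch\<close> read backwards, with cop \<open>i\<close>
  stepping onto \<open>r\<close> and all others staying. As \<open>move\<close> is reflexive on
  vertices, this also excludes \<open>p i = r\<close>.\<close>

lemma safe_not_move:
  assumes "safe G I p r" "finite I" "i \<in> I" "\<And>j. j \<in> I \<Longrightarrow> p j \<in> verts G"
  shows "\<not> move G (p i) r"
proof
  assume "move G (p i) r"
  then have "list_all2 (move G) (map p (sorted_list_of_set I)) (map (p(i := r)) (sorted_list_of_set I))"
    using assms by (auto simp: list_all2_map1 list_all2_map2 move_def intro!: list.rel_refl_strong)
  moreover have "r \<in> set (map (p(i := r)) (sorted_list_of_set I))"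
    using assms by (auto simp: image_iff intro!: bexI[of _ i])
  ultimately show False
    using assms(1) cops_force.catch unfolding safe_def by metis
qed

locale evading_robber = graph G for G :: "('a, 'b) pre_digraph" +
  fixes k :: nat and Q :: "nat \<Rightarrow> 'a set"
  assumes conn: "connected G"
    and evades: "\<not> cops_win G (k - 1)"
    and cover: "(\<Union>i<k. Q i) = verts G"
    and cliques: "\<And>i. i < k \<Longrightarrow> clique G (Q i)"
    and nonempty: "\<And>i. i < k \<Longrightarrow> Q i \<noteq> {}"
    and disjoint: "\<And>i j. i < k \<Longrightarrow> j < k \<Longrightarrow> i \<noteq> j \<Longrightarrow> Q i \<inter> Q j = {}"
begin

lemma adj_sym: "u \<rightarrow>\<^bsub>G\<^esub> v \<longleftrightarrow> v \<rightarrow>\<^bsub>G\<^esub> u"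
  using sym_arcs by (auto simp: symmetric_def sym_def)

lemma adj_irrefl: "\<not> u \<rightarrow>\<^bsub>G\<^esub> u"
  using adj_not_same by blast

lemma Q_verts: "i < k \<Longrightarrow> u \<in> Q i \<Longrightarrow> u \<in> verts G"
  using cliques unfolding clique_def by blast

lemma Q_adj: "i < k \<Longrightarrow> u \<in> Q i \<Longrightarrow> v \<in> Q i \<Longrightarrow> u \<noteq> v \<Longrightarrow> u \<rightarrow>\<^bsub>G\<^esub> v"
  using cliques unfolding clique_def by blast

lemma Q_move: "i < k \<Longrightarrow> u \<in> Q i \<Longrightarrow> v \<in> Q i \<Longrightarrow> move G u v"
  unfolding move_def using Q_adj Q_verts by blast

lemma adj_move: "u \<rightarrow>\<^bsub>G\<^esub> v \<Longrightarrow> move G u v"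
  unfolding move_def using adj_in_verts by blast

text \<open>The names of the cops when \<open>Q h\<close> starts without a cop. A cop keeps its name
  when it changes cliques.\<close>

definition others :: "nat \<Rightarrow> nat set" where
  "others h = {..<k} - {h}"

lemma finite_others [simp]: "finite (others h)"
  by (simp add: others_def)

lemma safe_exists:
  assumes "h < k" "\<And>i. i \<in> others h \<Longrightarrow> p i \<in> verts G"
  obtains r where "safe G (others h) p r"
proof -
  have "length (map p (sorted_list_of_set (others h))) = k - 1"
    "set (map p (sorted_list_of_set (others h))) \<subseteq> verts G"
    using assms by (auto simp: others_def)
  then show ?thesis
    using cops_win_if_cops_force evades that unfolding safe_def by blast
qed

text \<open>A cop inside a clique reaches all of it in one move, so a safe robber is in a clique
  without a cop; \<open>H\<close> collects the cliques that may be without one.\<close>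

lemma safe_confined:
  assumes "safe G I p r" "finite I" "\<And>i. i \<in> I \<Longrightarrow> p i \<in> verts G"
    and "\<And>j. j < k \<Longrightarrow> j \<notin> H \<Longrightarrow> \<exists>i\<in>I. p i \<in> Q j"
  obtains j where "j \<in> H" "j < k" "r \<in> Q j"
proof -
  have "r \<in> verts G"
    using assms(1) by (simp add: safe_def)
  then obtain j where j: "j < k" "r \<in> Q j"
    using cover by blast
  have "j \<in> H"
  proof (rule ccontr)
    assume "j \<notin> H"
    then obtain i where i: "i \<in> I" "p i \<in> Q j"
      using assms(4) j by blast
    have "\<not> move G (p i) r"
      by (rule safe_not_move) (use assms i in auto)
    then show False
      using Q_move j i by blast
  qed
  then show ?thesis
    using that j by blast
qed

section \<open>Edges between any two cliques\<close>

lemma cliques_joined: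
  assumes "i < k" "h < k" "i \<noteq> h"
  obtains u v where "u \<in> Q i" "v \<in> Q h" "u \<rightarrow>\<^bsub>G\<^esub> v"
proof (rule ccontr)
  assume "\<not> thesis"
  with that have none: "\<not> u \<rightarrow>\<^bsub>G\<^esub> v" if "u \<in> Q i" "v \<in> Q h" for u v
    using \<open>u \<in> Q i\<close> \<open>v \<in> Q h\<close> by blast
  define p where "p j = (SOME x. x \<in> Q j)" for j
  have p: "p j \<in> Q j" if "j < k" for j
    using nonempty[OF that] by (simp add: p_def some_in_eq)
  have pv: "(p(i := x)) j \<in> verts G" if "j \<in> others h" "x \<in> verts G" for j x
    using that p Q_verts by (auto simp: others_def)
  have occ: "\<exists>l\<in>others h. (p(i := x)) l \<in> Q j" if "j < k" "j \<notin> {i, h}" for x j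
    using that p by (intro bexI[of _ j]) (auto simp: others_def)
  have "strongly_connected G"
    using conn sym_arcs symmetric_connected_imp_strongly_connected by blast
  moreover obtain z where z: "z \<in> Q h"
    using nonempty assms by blast
  ultimately have "p i \<rightarrow>\<^sup>*\<^bsub>G\<^esub> z"
    using p Q_verts assms by (meson strongly_connectedE)
  \<comment> \<open>Invariant of cop \<open>i\<close>'s walk to \<open>z\<close>, all other cops
    standing still: the robber remains in \<open>Q h\<close>.\<close>
  then have "\<exists>r\<in>Q h. safe G (others h) (p(i := z)) r"
  proof (induction rule: reachable_induct)
    case base
    obtain r where r: "safe G (others h) p r"
      by (rule safe_exists[of h p]) (use assms p Q_verts in \<open>auto simp: others_def\<close>)
    obtain j where "j \<in> {h}" "j < k" "r \<in> Q j"
      by (rule safe_confined[OF r, of "{h}"])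
        (use p Q_verts in \<open>auto simp: others_def\<close>)
    then show ?case
      using r by auto
  next
    case (step x y)
    then obtain r where r: "r \<in> Q h" "safe G (others h) (p(i := x)) r"
      by blast
    have yv: "y \<in> verts G"
      using step by (auto intro: adj_in_verts)
    obtain r' where r': "move G r r'" "safe G (others h) (p(i := y)) r'"
      by (rule safe_move[OF r(2), of "p(i := y)"])
        (use p Q_verts adj_move step Q_move in \<open>auto simp: others_def\<close>)
    \<comment> \<open>Cop \<open>i\<close> may have left its clique, so \<open>Q i\<close> could be
      open too; the absence of edges between \<open>Q h\<close> and \<open>Q i\<close> rules it
      out.\<close>
    obtain j where j: "j \<in> {i, h}" "j < k" "r' \<in> Q j"
      by (rule safe_confined[OF r'(2), of "{i, h}"]) (use pv yv occ in \<open>auto simp del: fun_upd_apply\<close>)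
    have "r' \<notin> Q i"
      using r'(1) r(1) none disjoint[OF assms] adj_sym by (auto simp: move_def)
    then show ?case
      using j r'(2) by blast
  qed
  then obtain r where r: "r \<in> Q h" "safe G (others h) (p(i := z)) r"
    by blast
  have "\<not> move G ((p(i := z)) i) r"
    by (rule safe_not_move[OF r(2)])
      (use pv[of _ z] z Q_verts assms in \<open>auto simp: others_def simp del: fun_upd_apply\<close>)
  then show False
    using Q_move z r assms by simp
qed

section \<open>The induced path through all cliques\<close>

text \<open>In round \<open>n\<close> the robber is on \<open>v n\<close>, each cop
  \<open>j < n\<close> on \<open>v (j - 1)\<close>, and cop \<open>n\<close> has just entered
  \<open>Q (n - 1)\<close> at \<open>w (n - 1)\<close>; each later cop waits on \<open>p j\<close>,
  next to \<open>w (j - 1)\<close>. When the robber reaches \<open>v (n + 1)\<close>, cops stand on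
  \<open>v 0, ..., v (n - 1)\<close>, so he is adjacent to none of these.\<close>

lemma induced_transversal_path_prefix:
  assumes w: "\<And>i. Suc i < k \<Longrightarrow> w i \<in> Q i \<and> p (Suc i) \<in> Q (Suc i) \<and> p (Suc i) \<rightarrow>\<^bsub>G\<^esub> w i"
    and "n < k"
  shows "\<exists>v. (\<forall>i\<le>n. v i \<in> Q i) \<and> (\<forall>i<n. v i \<rightarrow>\<^bsub>G\<^esub> v (Suc i)) \<and>
    (\<forall>j\<le>n. \<forall>i. Suc i < j \<longrightarrow> \<not> v i \<rightarrow>\<^bsub>G\<^esub> v j) \<and>
    safe G (others 0) (\<lambda>j. if j < n then v (j - 1) else if j = n then w (n - 1) else p j) (v n)"
  using \<open>n < k\<close>
proof (induction n)
  case 0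
  have pQ: "p j \<in> Q j" if "j \<in> others 0" for j
    using that w[of "j - 1"] by (auto simp: others_def)
  obtain r where r: "safe G (others 0) p r"
    by (rule safe_exists[of 0 p]) (use 0 pQ Q_verts in \<open>auto simp: others_def\<close>)
  obtain j where "j \<in> {0}" "j < k" "r \<in> Q j"
    by (rule safe_confined[OF r, of "{0}"]) (use pQ Q_verts in \<open>auto simp: others_def\<close>)
  \<comment> \<open>Index 0 is no cop's name here, so for \<open>n = 0\<close> the formula agrees
    with \<open>p\<close>.\<close>
  moreover have "safe G (others 0) (\<lambda>j. if j < 0 then r else if j = 0 then w (0 - 1) else p j) r"
  proof -
    have "map (\<lambda>j. if j < 0 then r else if j = 0 then w (0 - 1) else p j) (sorted_list_of_set (others 0))
      = map p (sorted_list_of_set (others 0))"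
      by (auto simp: others_def)
    then show ?thesis
      using r unfolding safe_def by (simp only:) simp
  qed
  ultimately show ?case
    by (intro exI[of _ "\<lambda>_. r"]) auto
next
  case (Suc n)
  then obtain v where v: "\<And>i. i \<le> n \<Longrightarrow> v i \<in> Q i" "\<And>i. i < n \<Longrightarrow> v i \<rightarrow>\<^bsub>G\<^esub> v (Suc i)"
    "\<And>i j. j \<le> n \<Longrightarrow> Suc i < j \<Longrightarrow> \<not> v i \<rightarrow>\<^bsub>G\<^esub> v j"
    and s: "safe G (others 0) (\<lambda>j. if j < n then v (j - 1) else if j = n then w (n - 1) else p j) (v n)"
      (is "safe G _ ?c _")
    by (auto simp del: diff_Suc_1 One_nat_def) (metis (no_types, lifting))
  \<comment> \<open>The next round: cop \<open>n\<close> (if \<open>n > 0\<close>) steps inside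
    \<open>Q (n - 1)\<close> onto \<open>v (n - 1)\<close>, which the robber has left, cop
    \<open>n + 1\<close> crosses into \<open>Q n\<close>, and the others stay.\<close>
  let ?d = "\<lambda>j. if j \<le> n then v (j - 1) else if j = Suc n then w n else p j"
  have pQ: "p j \<in> Q j" if "j \<in> others 0" for j
    using that w[of "j - 1"] by (auto simp: others_def)
  have wn: "w n \<in> Q n" "p (Suc n) \<rightarrow>\<^bsub>G\<^esub> w n"
    using w Suc.prems by auto
  have moves: "move G (?c j) (?d j)" if j: "j \<in> others 0" for j
  proof -
    consider "j < n" | "j = n" | "j = Suc n" | "j > Suc n"
      by linarith
    then show ?thesis
    proof cases
      case 1
      then show ?thesis
        using v(1)[of "j - 1"] Q_move[of "j - 1"] Suc.prems by auto
    next
      case 2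
      then show ?thesis
        using v(1)[of "j - 1"] w[of "j - 1"] Q_move[of "j - 1"] Suc.prems j by (auto simp: others_def)
    next
      case 3
      then show ?thesis
        using wn adj_move by simp
    next
      case 4
      then show ?thesis
        using pQ[OF j] Q_move[of j] j by (auto simp: others_def)
    qed
  qed
  then have dv: "?d j \<in> verts G" if "j \<in> others 0" for j
    using that unfolding move_def by blast
  obtain r where r: "move G (v n) r" "safe G (others 0) ?d r"
    by (rule safe_move[OF s, of ?d]) (use moves in auto)
  have away: "\<not> move G (?d j) r" if "j \<in> others 0" for j
    by (rule safe_not_move[OF r(2)]) (use that dv in auto)
  \<comment> \<open>Each clique \<open>Q j\<close> with \<open>j <= n\<close> is now held by cop
    \<open>j + 1\<close>, so only \<open>Q (n + 1)\<close> is open.\<close>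
  have occ: "\<exists>l\<in>others 0. ?d l \<in> Q j" if j: "j < k" "j \<notin> {Suc n}" for j
  proof (cases "j \<le> n")
    case True
    then show ?thesis
      using v(1)[of j] wn Suc.prems
      by (intro bexI[of _ "Suc j"]) (auto simp: others_def not_less_eq_eq dest: le_antisym)
  next
    case False
    then show ?thesis
      using pQ[of j] j by (intro bexI[of _ j]) (auto simp: others_def)
  qed
  obtain j where "j \<in> {Suc n}" "j < k" "r \<in> Q j"
    by (rule safe_confined[OF r(2), of "{Suc n}"]) (use dv occ in auto)
  then have rQ: "r \<in> Q (Suc n)"
    by simp
  have "r \<noteq> v n"
    using away[of "Suc n"] Q_move[of n] v(1)[of n] wn Suc.prems by (auto simp: others_def)
  then have adj: "v n \<rightarrow>\<^bsub>G\<^esub> r"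
    using r(1) by (auto simp: move_def)
  have nonadj: "\<not> v i \<rightarrow>\<^bsub>G\<^esub> r" if "i < n" for i
    using away[of "Suc i"] that adj_move Suc.prems by (auto simp: others_def)
  let ?v = "v(Suc n := r)"
  have "safe G (others 0) (\<lambda>j. if j < Suc n then ?v (j - 1) else if j = Suc n then w (Suc n - 1) else p j)
      (?v (Suc n))"
  proof -
    have "(\<lambda>j. if j < Suc n then ?v (j - 1) else if j = Suc n then w (Suc n - 1) else p j) = ?d"
      by (auto simp: fun_eq_iff)
    then show ?thesis
      using r(2) by (simp only: fun_upd_same)
  qed
  moreover have "\<forall>i\<le>Suc n. ?v i \<in> Q i" "\<forall>i<Suc n. ?v i \<rightarrow>\<^bsub>G\<^esub> ?v (Suc i)"
    "\<forall>j\<le>Suc n. \<forall>i. Suc i < j \<longrightarrow> \<not> ?v i \<rightarrow>\<^bsub>G\<^esub> ?v j"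
    using v rQ adj nonadj by (auto simp: le_Suc_eq less_Suc_eq)
  ultimately show ?case
    by (intro exI[of _ ?v]) blast
qed

lemma induced_transversal_path:
  assumes "k > 0"
  obtains v where "\<And>i. i < k \<Longrightarrow> v i \<in> Q i" "\<And>i. Suc i < k \<Longrightarrow> v i \<rightarrow>\<^bsub>G\<^esub> v (Suc i)"
    "\<And>i j. j < k \<Longrightarrow> Suc i < j \<Longrightarrow> \<not> v i \<rightarrow>\<^bsub>G\<^esub> v j"
proof -
  have "\<forall>i. \<exists>a b. Suc i < k \<longrightarrow> a \<in> Q i \<and> b \<in> Q (Suc i) \<and> b \<rightarrow>\<^bsub>G\<^esub> a"
    using cliques_joined by (metis Suc_lessD n_not_Suc_n)
  then obtain w b where wb: "\<And>i. Suc i < k \<Longrightarrow> w i \<in> Q i \<and> b i \<in> Q (Suc i) \<and> b i \<rightarrow>\<^bsub>G\<^esub> w i"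
    by metis
  \<comment> \<open>Below, an index shift: \<open>b i\<close> is the end in \<open>Q (Suc i)\<close>
    of the joining edge, hence the waiting place of cop \<open>Suc i\<close>.\<close>
  have "k - 1 < k"
    using assms by simp
  from induced_transversal_path_prefix[of w "\<lambda>i. b (i - 1)", OF _ this] wb obtain v where
    v: "\<forall>i\<le>k - 1. v i \<in> Q i" "\<forall>i<k - 1. v i \<rightarrow>\<^bsub>G\<^esub> v (Suc i)"
    "\<forall>j\<le>k - 1. \<forall>i. Suc i < j \<longrightarrow> \<not> v i \<rightarrow>\<^bsub>G\<^esub> v j"
    by auto
  show ?thesis
    by (rule that[of v]) (use v in auto)
qed

text \<open>The robber is on \<open>x\<close> while the cops stand on the \<open>v i\<close> with
  \<open>i\<close> other than \<open>m - 1\<close>, and on \<open>y\<close> after the advance. The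
  non-adjacencies of \<open>x\<close> come from the placement before the advance, those of
  \<open>y\<close> from the one after it.\<close>

lemma close_transversal_path:
  assumes v: "\<And>i. i < k \<Longrightarrow> v i \<in> Q i" "\<And>i. Suc i < k \<Longrightarrow> v i \<rightarrow>\<^bsub>G\<^esub> v (Suc i)"
    and m: "2 \<le> m" "m \<le> k"
  obtains x y where "x \<in> Q (m - 1)" "y \<in> Q 0" "x \<rightarrow>\<^bsub>G\<^esub> y"
    "\<And>i. i < m - 1 \<Longrightarrow> \<not> move G (v i) x" "\<And>i. 0 < i \<Longrightarrow> i < m \<Longrightarrow> \<not> move G (v i) y"
proof -
  let ?I = "others (m - 1)"
  \<comment> \<open>Index \<open>m - 1\<close> is no cop's name, so \<open>j < m\<close> picks the
    cops on \<open>v 0, ..., v (m - 2)\<close>. After their move every clique except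
    \<open>Q 0\<close> is guarded.\<close>
  let ?d = "\<lambda>j. if j < m then v (Suc j) else v j"
  have vv: "v i \<in> verts G" if "i \<in> ?I" for i
    using that v(1) Q_verts by (auto simp: others_def)
  obtain x where x: "safe G ?I v x"
    by (rule safe_exists[of "m - 1" v]) (use m vv in auto)
  obtain j where "j \<in> {m - 1}" "j < k" "x \<in> Q j"
    by (rule safe_confined[OF x, of "{m - 1}"]) (use vv v(1) in \<open>auto simp: others_def\<close>)
  then have xQ: "x \<in> Q (m - 1)"
    by simp
  have xv: "\<not> move G (v i) x" if "i < m - 1" for i
    by (rule safe_not_move[OF x]) (use that vv m in \<open>auto simp: others_def\<close>)
  have moves: "move G (v j) (?d j)" if "j \<in> ?I" for j
    using that v m adj_move Q_move[of j "v j" "v j"] by (auto simp: others_def)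
  then have dv: "?d j \<in> verts G" if "j \<in> ?I" for j
    using that unfolding move_def by blast
  obtain y where y: "move G x y" "safe G ?I ?d y"
    by (rule safe_move[OF x, of ?d]) (use moves in auto)
  have occ: "\<exists>l\<in>?I. ?d l \<in> Q j" if "j < k" "j \<notin> {0}" for j
    using that v(1) m
    by (intro bexI[of _ "if j < m then j - 1 else j"]) (auto simp: others_def)
  obtain j where "j \<in> {0}" "j < k" "y \<in> Q j"
    by (rule safe_confined[OF y(2), of "{0}"]) (use dv occ in auto)
  then have yQ: "y \<in> Q 0"
    by simp
  have yv: "\<not> move G (v i) y" if "0 < i" "i < m" for i
  proof -
    have "\<not> move G (?d (i - 1)) y"
      by (rule safe_not_move[OF y(2)]) (use that dv m in \<open>auto simp: others_def\<close>)
    moreover have "i - 1 < m" "Suc (i - 1) = i"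
      using that by auto
    ultimately show ?thesis
      by (simp only: if_True simp_thms)
  qed
  have "x \<noteq> y"
    using xQ yQ disjoint[of "m - 1" 0] m by fastforce
  then have "x \<rightarrow>\<^bsub>G\<^esub> y"
    using y(1) by (simp add: move_def)
  with xQ yQ xv yv show ?thesis
    using that by blast
qed

section \<open>Assembling induced cycles\<close>

text \<open>Comparing only \<open>i < j\<close> leaves a single wrap-around edge, from
  \<open>f 0\<close> to \<open>f (t - 1)\<close>, in place of the arithmetic modulo \<open>t\<close>
  in \<open>cycle_graph\<close>.\<close>

lemma has_induced_cycleI:
  assumes "t \<ge> 3" "\<And>i. i < t \<Longrightarrow> f i \<in> verts G" "inj_on f {..<t}"
    and "\<And>i j. i < j \<Longrightarrow> j < t \<Longrightarrow> f i \<rightarrow>\<^bsub>G\<^esub> f j \<longleftrightarrow> j = Suc i \<or> (i = 0 \<and> j = t - 1)"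
  shows "has_induced_cycle G t"
proof -
  let ?vs = "map f [0..<t]"
  let ?H = "G \<restriction> set ?vs"
  have sub: "set ?vs \<subseteq> verts G"
    using assms(2) by auto
  have mod: "Suc i mod t = (if i = t - 1 then 0 else Suc i)" if "i < t" for i
    using that by auto
  have H: "u \<rightarrow>\<^bsub>?H\<^esub> v \<longleftrightarrow> u \<rightarrow>\<^bsub>G\<^esub> v" if "u \<in> set ?vs" "v \<in> set ?vs" for u v
    using that unfolding arcs_ends_conv by (simp add: image_iff) blast
  have "?vs ! i \<rightarrow>\<^bsub>?H\<^esub> ?vs ! j \<longleftrightarrow> j = Suc i mod t \<or> i = Suc j mod t" if ij: "i < t" "j < t" for i j
  proof -
    have "?vs ! i \<rightarrow>\<^bsub>?H\<^esub> ?vs ! j \<longleftrightarrow> f i \<rightarrow>\<^bsub>G\<^esub> f j"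
      using ij H[of "f i" "f j"] by auto
    also have "\<dots> \<longleftrightarrow> j = Suc i mod t \<or> i = Suc j mod t"
    proof (cases i j rule: linorder_cases)
      case less
      then show ?thesis
        using assms(4)[OF less] ij mod assms(1) by auto
    next
      case equal
      then show ?thesis
        using adj_irrefl ij mod assms(1) by auto
    next
      case greater
      then show ?thesis
        using assms(4)[OF greater] adj_sym[of "f i"] ij mod assms(1) by auto
    qed
    finally show ?thesis .
  qed
  moreover have "distinct ?vs"
    using assms(3) by (simp add: distinct_map lessThan_atLeast0)
  ultimately have "cycle_graph t ?H"
    unfolding cycle_graph_def using assms(1) by (intro conjI exI[of _ ?vs]) auto
  moreover have "induced_subgraph ?H G"
    using sub by (rule induced_induce)
  ultimately show ?thesis
    unfolding has_induced_cycle_def by blast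
qed

lemma induced_cycle_ge4:
  assumes "2 \<le> m" "m \<le> k"
  shows "has_induced_cycle G (m + 2)"
proof -
  obtain v where v: "\<And>i. i < k \<Longrightarrow> v i \<in> Q i" "\<And>i. Suc i < k \<Longrightarrow> v i \<rightarrow>\<^bsub>G\<^esub> v (Suc i)"
    "\<And>i j. j < k \<Longrightarrow> Suc i < j \<Longrightarrow> \<not> v i \<rightarrow>\<^bsub>G\<^esub> v j"
    using induced_transversal_path assms by (metis gr0I le_zero_eq not_numeral_le_zero)
  obtain x y where xy: "x \<in> Q (m - 1)" "y \<in> Q 0" "x \<rightarrow>\<^bsub>G\<^esub> y"
    and x: "\<And>i. i < m - 1 \<Longrightarrow> \<not> move G (v i) x"
    and y: "\<And>i. 0 < i \<Longrightarrow> i < m \<Longrightarrow> \<not> move G (v i) y"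
    using close_transversal_path[of v m] v(1,2) assms by metis
  define f where "f i = (if i < m then v i else if i = m then x else y)" for i
  \<comment> \<open>\<open>v (m - 2)\<close> is adjacent to \<open>v (m - 1)\<close> but not to
    \<open>x\<close>.\<close>
  have "x \<noteq> v (m - 1)"
  proof
    assume "x = v (m - 1)"
    then have "move G (v (m - 2)) x"
      using v(2)[of "m - 2"] assms adj_move by (simp add: Suc_diff_Suc numeral_2_eq_2)
    then show False
      using x[of "m - 2"] assms by simp
  qed
  then have vx: "v (m - 1) \<rightarrow>\<^bsub>G\<^esub> x"
    using Q_adj[of "m - 1"] v(1)[of "m - 1"] xy(1) assms by auto
  \<comment> \<open>Likewise \<open>v 1\<close> is adjacent to \<open>v 0\<close> but not to
    \<open>y\<close>.\<close>
  have "y \<noteq> v 0"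
    using y[of 1] v(2)[of 0] adj_sym[of "v 0"] adj_move assms by auto
  then have vy: "v 0 \<rightarrow>\<^bsub>G\<^esub> y"
    using Q_adj[of 0] v(1)[of 0] xy(2) assms by auto
  have adj: "f i \<rightarrow>\<^bsub>G\<^esub> f j \<longleftrightarrow> j = Suc i \<or> (i = 0 \<and> j = m + 2 - 1)"
    and neq: "f i \<noteq> f j" if ij: "i < j" "j < m + 2" for i j
  proof -
    \<comment> \<open>In turn: two path vertices, a path vertex and \<open>x\<close>, a path vertex
      and \<open>y\<close>, and the edge from \<open>x\<close> to \<open>y\<close>.\<close>
    consider "j < m" | "j = m" "i < m - 1" | "j = m" "i = m - 1"
      | "j = Suc m" "i = 0" | "j = Suc m" "0 < i" "i < m" | "j = Suc m" "i = m"
      using ij by linarith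
    then have "(f i \<rightarrow>\<^bsub>G\<^esub> f j \<longleftrightarrow> j = Suc i \<or> (i = 0 \<and> j = m + 2 - 1)) \<and> f i \<noteq> f j"
    proof cases
      case 1
      then have "v i \<noteq> v j"
        using v(1)[of i] v(1)[of j] disjoint[of i j] ij assms by auto
      moreover have "v i \<rightarrow>\<^bsub>G\<^esub> v j \<longleftrightarrow> j = Suc i"
        using v(2)[of i] v(3)[of j i] 1 ij assms by (cases "j = Suc i") auto
      ultimately show ?thesis
        using 1 ij by (auto simp: f_def)
    next
      case 2
      then show ?thesis
        using x[of i] adj_move[of "v i" x] Q_move[of i "v i" "v i"] v(1)[of i] assms
        by (auto simp: f_def)
    next
      case 3
      then show ?thesis
        using vx \<open>x \<noteq> v (m - 1)\<close> assms by (auto simp: f_def)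
    next
      case 4
      then show ?thesis
        using vy \<open>y \<noteq> v 0\<close> assms by (auto simp: f_def)
    next
      case 5
      then show ?thesis
        using y[of i] adj_move[of "v i" y] Q_move[of i "v i" "v i"] v(1)[of i] assms
        by (auto simp: f_def)
    next
      case 6
      then show ?thesis
        using xy(3) adj_irrefl by (auto simp: f_def)
    qed
    then show "f i \<rightarrow>\<^bsub>G\<^esub> f j \<longleftrightarrow> j = Suc i \<or> (i = 0 \<and> j = m + 2 - 1)" "f i \<noteq> f j"
      by auto
  qed
  show ?thesis
  proof (rule has_induced_cycleI)
    show "inj_on f {..<m + 2}"
      using neq by (intro linorder_inj_onI) auto
    show "f i \<in> verts G" if "i < m + 2" for i
      using that v(1)[of i] xy Q_verts[of i] Q_verts[of 0] Q_verts[of "m - 1"] assms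
      by (auto simp: f_def)
  qed (use assms adj in auto)
qed

section \<open>A triangle inside one clique\<close>

text \<open>Otherwise cops on the \<open>p i\<close> would win: with every other clique guarded, the
  robber must start in \<open>Q h\<close>, next to a cop.\<close>

lemma not_dominated:
  assumes "h < k" "\<And>i. i \<in> others h \<Longrightarrow> p i \<in> Q i"
  obtains r where "r \<in> Q h" "\<And>i. i \<in> others h \<Longrightarrow> \<not> p i \<rightarrow>\<^bsub>G\<^esub> r"
proof -
  have pv: "p i \<in> verts G" if "i \<in> others h" for i
    using that assms(2)[OF that] Q_verts by (auto simp: others_def)
  obtain r where r: "safe G (others h) p r"
    by (rule safe_exists[of h p]) (use assms pv in auto)
  obtain j where "j \<in> {h}" "j < k" "r \<in> Q j"
    by (rule safe_confined[OF r, of "{h}"]) (use pv assms in \<open>auto simp: others_def\<close>)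
  moreover have "\<not> p i \<rightarrow>\<^bsub>G\<^esub> r" if "i \<in> others h" for i
    using safe_not_move[OF r _ that] pv adj_move by auto
  ultimately show ?thesis
    using that by blast
qed

text \<open>
  If \<open>Q 1\<close> had only two vertices, each would have a neighbour in \<open>Q 0\<close> and one of them a neighbour in
  \<open>Q 2\<close>, so two cops would dominate \<open>Q 1\<close>.
\<close>

lemma induced_triangle:
  assumes "3 \<le> k"
  shows "has_induced_cycle G 3"
proof -
  obtain v where v: "\<And>i. i < k \<Longrightarrow> v i \<in> Q i" "\<And>i. Suc i < k \<Longrightarrow> v i \<rightarrow>\<^bsub>G\<^esub> v (Suc i)"
    using induced_transversal_path assms by (metis gr0I le_zero_eq not_numeral_le_zero)
  \<comment> \<open>For \<open>m = 2\<close> this gives a vertex \<open>x\<close> of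
    \<open>Q 1\<close> that, unlike \<open>v 1\<close>, is not adjacent to \<open>v 0\<close>, so it
    is a second vertex of \<open>Q 1\<close>.\<close>
  obtain x y where xy: "x \<in> Q 1" "y \<in> Q 0" "x \<rightarrow>\<^bsub>G\<^esub> y" and x: "\<not> move G (v 0) x"
    by (rule close_transversal_path[of v 2]) (use v assms in auto)
  have v01: "v 0 \<rightarrow>\<^bsub>G\<^esub> v 1"
    using v(2)[of 0] assms by simp
  then have "x \<noteq> v 1"
    using x adj_move by blast
  obtain a b where ab: "a \<in> Q 2" "b \<in> Q 1" "a \<rightarrow>\<^bsub>G\<^esub> b"
    using cliques_joined[of 2 1] assms by auto
  \<comment> \<open>The cop on \<open>a\<close> dominates \<open>b\<close>; if \<open>b\<close> is
    \<open>x\<close> or \<open>v 1\<close>, the cop on \<open>c\<close> dominates the other of the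
    two.\<close>
  define c where "c = (if b = x then v 0 else y)"
  have c: "c \<in> Q 0"
    using v(1)[of 0] xy assms by (simp add: c_def)
  obtain z where z: "z \<in> Q 1" "\<And>i. i \<in> others 1 \<Longrightarrow> \<not> (v(0 := c, 2 := a)) i \<rightarrow>\<^bsub>G\<^esub> z"
    by (rule not_dominated[of 1 "v(0 := c, 2 := a)"])
      (use assms v(1) ab c in \<open>auto simp: others_def\<close>)
  have "\<not> c \<rightarrow>\<^bsub>G\<^esub> z" "\<not> a \<rightarrow>\<^bsub>G\<^esub> z"
    using z(2)[of 0] z(2)[of 2] assms by (auto simp: others_def)
  moreover have "y \<rightarrow>\<^bsub>G\<^esub> x"
    using xy(3) adj_sym by blast
  ultimately have "(b = x \<or> b = v 1) \<longrightarrow> z \<noteq> x \<and> z \<noteq> v 1"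
    using ab(3) v01 by (auto simp: c_def split: if_splits)
  \<comment> \<open>If \<open>b\<close> is neither \<open>x\<close> nor \<open>v 1\<close>, it is
    the third vertex; otherwise \<open>z\<close> is.\<close>
  then have "\<exists>z\<in>Q 1. z \<noteq> x \<and> z \<noteq> v 1"
    using z(1) ab(2) by blast
  then obtain z where z: "z \<in> Q 1" "z \<noteq> x" "z \<noteq> v 1"
    by blast
  define f where "f i = (if i = 0 then v 1 else if i = 1 then x else z)" for i :: nat
  have fQ: "f i \<in> Q 1" for i
    using v(1)[of 1] z xy assms by (simp add: f_def)
  have inj: "inj_on f {..<3}"
    using z \<open>x \<noteq> v 1\<close> by (auto simp: f_def inj_on_def split: if_splits)
  show ?thesis
  proof (rule has_induced_cycleI[OF _ _ inj])
    fix i j :: nat assume ij: "i < j" "j < 3"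
    then have "f i \<rightarrow>\<^bsub>G\<^esub> f j"
      using Q_adj[OF _ fQ fQ, of i j] inj_on_eq_iff[OF inj, of i j] assms by simp
    then show "f i \<rightarrow>\<^bsub>G\<^esub> f j \<longleftrightarrow> j = Suc i \<or> (i = 0 \<and> j = 3 - 1)"
      using ij by auto
  qed (use fQ Q_verts[of 1] assms in auto)
qed

end

section \<open>From the two graph parameters to indexed cliques\<close>

text \<open>Ensures that the \<open>LEAST\<close> in \<open>clique_cover_number\<close> is
  attained.\<close>

lemma clique_partition_singletons:
  assumes "finite (verts G)"
  shows "clique_partition G ((\<lambda>v. {v}) ` verts G)"
  using assms by (auto simp: clique_partition_def clique_def partition_on_def disjoint_def)

theorem theorem1p2:
  fixes G :: "('a, 'b) pre_digraph" and k :: nat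
  assumes "k \<ge> 3"
    and "graph G"
    and "connected G"
    and "cop_number G = k"
    and "clique_cover_number G = k"
  shows "\<forall>t::nat. 3 \<le> t \<and> t \<le> k + 1 \<longrightarrow> has_induced_cycle G t"
proof -
  interpret graph G
    by fact
  have "\<exists>n P. clique_partition G P \<and> card P = n"
    using clique_partition_singletons finite_verts by blast
  from LeastI_ex[OF this] have "\<exists>P. clique_partition G P \<and> card P = k"
    using assms(5) unfolding clique_cover_number_def by simp
  then obtain P where P: "clique_partition G P" "card P = k"
    by blast
  then obtain Q where Q: "bij_betw Q {..<k} P"
    using ex_bij_betw_nat_finite[of P] by (auto simp: clique_partition_def lessThan_atLeast0)
  have QP: "Q i \<in> P" if "i < k" for i
    using Q that by (auto simp: bij_betw_def)
  have part: "partition_on (verts G) P"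
    using P by (simp add: clique_partition_def)
  interpret evading_robber G k Q
  proof
    \<comment> \<open>\<open>k - 1\<close> lies below the least winning number of cops, as
      \<open>k\<close> is positive.\<close>
    show "\<not> cops_win G (k - 1)"
      using assms(1,4) not_less_Least[of "k - 1" "cops_win G"] by (simp add: cop_number_def)
    show "(\<Union>i<k. Q i) = verts G"
      using Q part by (auto simp: bij_betw_def partition_on_def)
    show "clique G (Q i)" if "i < k" for i
      using P QP[OF that] by (simp add: clique_partition_def)
    show "Q i \<noteq> {}" if "i < k" for i
      using part QP[OF that] by (auto simp: partition_on_def)
    show "Q i \<inter> Q j = {}" if "i < k" "j < k" "i \<noteq> j" for i j
    proof -
      have "Q i \<noteq> Q j"
        using Q that by (auto simp: bij_betw_def inj_on_def)
      then show ?thesis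
        using part QP that by (auto simp: partition_on_def disjoint_def)
    qed
  qed (use assms in auto)
  show ?thesis
  proof (intro allI impI)
    fix t :: nat assume t: "3 \<le> t \<and> t \<le> k + 1"
    show "has_induced_cycle G t"
    \<comment> \<open>The closed path has length \<open>m + 2\<close> with \<open>m >= 2\<close>, so
      length 3 is treated separately.\<close>
    proof (cases "t = 3")
      case True
      then show ?thesis
        using induced_triangle assms(1) by simp
    next
      case False
      then have "2 \<le> t - 2" "t - 2 \<le> k" "t - 2 + 2 = t"
        using t by auto
      then show ?thesis
        using induced_cycle_ge4[of "t - 2"] by simp
    qed
  qed
qed

end
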